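(* Let $a\geq 2$ be an integer and let $D$ be a balanced bipartite digraph with colour classes $X$ and $Y$, where $|X|=|Y|=a$. Suppose that $D$ satisfies condition $A^*_2$, i.e. \[ d^+(u)+d^-(v)\geq a+2 \] for all vertices $u$ and $v$ from opposite colour classes (that is, $u\in X,\ v\in Y$ or $u\in Y,\ v\in X$) such that $uv\notin A(D)$. Then $D$ contains an oriented cycle of length $2a$.
   Context: A digraph $D$ is a pair $(V(D),A(D))$ with $V(D)$ a finite set of vertices and $A(D)$ a set of ordered pairs of distinct vertices, called arcs (no loops, no multiple arcs; both $uv$ and $vu$ may be arcs). We write $uv\in A(D)$ for $(u,v)\in A(D)$. $D$ is bipartite with colour classes $X$ and $Y$ if $V(D)$ is the disjoint union of $X$ and $Y$ and no arc has both ends in $X$ or both ends in $Y$; it is balanced if $|X|=|Y|$. For a vertex $v$, $d^+(v)$ is the number of vertices $u$ with $vu\in A(D)$, and $d^-(v)$ is the number of vertices $u$ with $uv\in A(D)$. An oriented cycle of length $m$ consists of pairwise distinct vertices $v_1,\dots,v_m$ with $v_iv_{i+1}\in A(D)$ for $1\le i<m$ and $v_mv_1\in A(D)$. *)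

theory Defs
  imports "Graph_Theory.Pair_Digraph"
begin

text \<open>
  Digraphs are the locale \<^locale>\<open>pair_digraph\<close>: a finite vertex set and a set of ordered
  pairs of distinct vertices.
\<close>

definition bipartite_classes :: "'a pair_pre_digraph \<Rightarrow> 'a set \<Rightarrow> 'a set \<Rightarrow> bool" where
  "bipartite_classes D X Y \<longleftrightarrow>
     pverts D = X \<union> Y \<and> X \<inter> Y = {} \<and> parcs D \<inter> (X \<times> X) = {} \<and> parcs D \<inter> (Y \<times> Y) = {}"

text \<open>
  The condition is imposed on both orientations: on non-arcs from \<open>X\<close> to \<open>Y\<close> and on non-arcs
  from \<open>Y\<close> to \<open>X\<close>.
\<close>

definition condition_A2_star :: "nat \<Rightarrow> 'a pair_pre_digraph \<Rightarrow> 'a set \<Rightarrow> 'a set \<Rightarrow> bool" where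
  "condition_A2_star a D X Y \<longleftrightarrow>
     (\<forall>u v. (u \<in> X \<and> v \<in> Y \<or> u \<in> Y \<and> v \<in> X) \<and> (u, v) \<notin> parcs D \<longrightarrow>
        out_degree (with_proj D) u + in_degree (with_proj D) v \<ge> a + 2)"

text \<open>
  The library counts arcs in its degrees and represents a cycle as its list of arcs. The
  following facts are the descriptions in terms of vertices.
\<close>

lemma out_degree_with_proj: "out_degree (with_proj D) v = card {u. (v, u) \<in> parcs D}"
proof -
  have "out_arcs (with_proj D) v = Pair v ` {u. (v, u) \<in> parcs D}"
    by (auto simp: out_arcs_def)
  then show ?thesis
    by (simp add: out_degree_def card_image inj_on_def)
qed

lemma in_degree_with_proj: "in_degree (with_proj D) v = card {u. (u, v) \<in> parcs D}"
proof -
  have "in_arcs (with_proj D) v = (\<lambda>u. (u, v)) ` {u. (u, v) \<in> parcs D}"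
    by (auto simp: in_arcs_def)
  then show ?thesis
    by (simp add: in_degree_def card_image inj_on_def)
qed

lemma pcas_iff_nth:
  "pcas u p w \<longleftrightarrow>
     (if p = [] then u = w
      else fst (p ! 0) = u \<and> snd (last p) = w
        \<and> (\<forall>i. Suc i < length p \<longrightarrow> snd (p ! i) = fst (p ! Suc i)))"
proof (induction u p w rule: pcas.induct)
  case (2 u e es v)
  show ?case
  proof (cases es)
    case Nil
    then show ?thesis by auto
  next
    case (Cons f fs)
    let ?P = "\<lambda>i. Suc i < length (e # es) \<longrightarrow> snd ((e # es) ! i) = fst ((e # es) ! Suc i)"
    have "(\<forall>i. ?P i) \<longleftrightarrow> ?P 0 \<and> (\<forall>i. ?P (Suc i))"
      by (metis not0_implies_Suc)
    then have P: "(\<forall>i. ?P i) \<longleftrightarrow> snd e = fst (es ! 0) \<and>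
        (\<forall>i. Suc i < length es \<longrightarrow> snd (es ! i) = fst (es ! Suc i))"
      using Cons by simp
    have "pcas u (e # es) v \<longleftrightarrow> fst e = u \<and> fst (es ! 0) = snd e \<and> snd (last es) = v
        \<and> (\<forall>i. Suc i < length es \<longrightarrow> snd (es ! i) = fst (es ! Suc i))"
      using 2 Cons by simp
    moreover have "fst ((e # es) ! 0) = fst e" "last (e # es) = last es"
      using Cons by simp_all
    ultimately show ?thesis
      unfolding P by (metis list.distinct(1))
  qed
qed simp

lemma tl_pawalk_verts: "pcas u p w \<Longrightarrow> tl (pawalk_verts u p) = map snd p"
proof -
  have "pcas u p w \<Longrightarrow> pawalk_verts u p = u # map snd p"
    by (induction u p w rule: pcas.induct) simp_all
  then show "pcas u p w \<Longrightarrow> tl (pawalk_verts u p) = map snd p" by simp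
qed

lemma (in pair_wf_digraph) ex_cycle_iff_vertices:
  assumes "m \<ge> 1"
  shows "(\<exists>p. cycle p \<and> length p = m) \<longleftrightarrow>
    (\<exists>vs. distinct vs \<and> length vs = m \<and> (\<forall>i. Suc i < m \<longrightarrow> (vs ! i, vs ! Suc i) \<in> parcs G)
       \<and> (vs ! (m - 1), vs ! 0) \<in> parcs G)"
proof
  assume "\<exists>p. cycle p \<and> length p = m"
  then obtain p u where p: "length p = m" "p \<noteq> []" "set p \<subseteq> parcs G" "pcas u p u"
    "distinct (map snd p)"
    by (auto simp: cycle_def awalk_def tl_pawalk_verts)
  let ?vs = "map snd p"
  have step: "snd (p ! i) = fst (p ! Suc i)" if "Suc i < m" for i
    using p that by (auto simp: pcas_iff_nth)
  have wrap: "snd (p ! (m - 1)) = fst (p ! 0)"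
    using p by (auto simp: pcas_iff_nth last_conv_nth)
  have mem: "(fst (p ! i), snd (p ! i)) \<in> parcs G" if "i < m" for i
    using p that by (metis nth_mem prod.collapse subsetD)
  have "(?vs ! i, ?vs ! Suc i) \<in> parcs G" if "Suc i < m" for i
    using step[OF that] mem[OF that] that p(1) by simp
  moreover have "(?vs ! (m - 1), ?vs ! 0) \<in> parcs G"
    using wrap mem[of 0] assms p(1) by simp
  ultimately show "\<exists>vs. distinct vs \<and> length vs = m
      \<and> (\<forall>i. Suc i < m \<longrightarrow> (vs ! i, vs ! Suc i) \<in> parcs G) \<and> (vs ! (m - 1), vs ! 0) \<in> parcs G"
    using p by (intro exI[of _ ?vs]) auto
next
  assume "\<exists>vs. distinct vs \<and> length vs = m
      \<and> (\<forall>i. Suc i < m \<longrightarrow> (vs ! i, vs ! Suc i) \<in> parcs G) \<and> (vs ! (m - 1), vs ! 0) \<in> parcs G"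
  then obtain vs where vs: "distinct vs" "length vs = m"
    "\<And>i. Suc i < m \<Longrightarrow> (vs ! i, vs ! Suc i) \<in> parcs G" "(vs ! (m - 1), vs ! 0) \<in> parcs G"
    by blast
  let ?p = "zip vs (tl vs @ [hd vs])"
  have ne: "vs \<noteq> []" using vs(2) assms by auto
  have len: "length ?p = m" using vs(2) assms by simp
  have nth_p: "?p ! i = (vs ! i, if Suc i < m then vs ! Suc i else vs ! 0)" if "i < m" for i
    using that vs(2) ne by (auto simp: nth_append nth_tl hd_conv_nth)
  have "set ?p \<subseteq> parcs G"
  proof
    fix e assume "e \<in> set ?p"
    then obtain i where i: "i < m" "e = ?p ! i" by (metis in_set_conv_nth len)
    show "e \<in> parcs G"
    proof (cases "Suc i < m")
      case True
      then show ?thesis using vs(3) i nth_p by simp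
    next
      case False
      then have "i = m - 1" using i by simp
      then show ?thesis using vs(4) i nth_p[of i] False by simp
    qed
  qed
  moreover have "pcas (vs ! 0) ?p (vs ! 0)"
  proof -
    have "?p \<noteq> []" using len assms by force
    moreover have "snd (last ?p) = vs ! 0"
      using nth_p[of "m - 1"] assms len \<open>?p \<noteq> []\<close> by (simp add: last_conv_nth)
    ultimately show ?thesis using nth_p assms len by (simp add: pcas_iff_nth)
  qed
  moreover have "distinct (map snd ?p)"
    using vs(1,2) ne by (cases vs) auto
  moreover have "vs ! 0 \<in> pverts G" using in_arcsD2[OF vs(4)] .
  moreover have "?p \<noteq> []" using len assms by force
  ultimately have "cycle ?p"
    by (auto simp: cycle_def awalk_def tl_pawalk_verts intro!: exI[of _ "vs ! 0"])
  then show "\<exists>p. cycle p \<and> length p = m" using len by blast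
qed

end

theory Submission
  imports Defs
begin

text \<open>
  A maximum matching of arcs from \<open>X\<close> to \<open>Y\<close> is perfect. Contracting the arcs \<open>x \<rightarrow> f x\<close> of a
  perfect matching gives a digraph on \<open>X\<close> whose Hamiltonian cycles lift to \<open>D\<close>, and the degree
  condition becomes Woodall's. Woodall's theorem follows as in Bondy and Thomassen's proof of
  Meyniel's theorem: a longest cycle has a bypass with shortest possible gap, and all vertices of
  the gap can be inserted into the rest of the cycle.
\<close>

section \<open>Perfect matchings\<close>

text \<open>A partial matching of size \<open>k < card X\<close> is augmented. For unmatched
  \<open>u\<close> and \<open>v\<close>, either one of them has an unmatched neighbour, or an
  augmenting path of length three joins them.\<close>

lemma matching_of_degree_sum:
  fixes E :: "'a \<Rightarrow> 'b \<Rightarrow> bool"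
  assumes fin: "finite X" "finite Y" and eq: "card X = card Y"
    and deg: "\<And>u v. u \<in> X \<Longrightarrow> v \<in> Y \<Longrightarrow> \<not> E u v \<Longrightarrow>
      card X \<le> card {y \<in> Y. E u y} + card {x \<in> X. E x v}"
  shows "\<exists>f. bij_betw f X Y \<and> (\<forall>x\<in>X. E x (f x))"
proof -
  have "\<exists>S f. S \<subseteq> X \<and> card S = k \<and> inj_on f S \<and> f ` S \<subseteq> Y \<and> (\<forall>x\<in>S. E x (f x))"
    if "k \<le> card X" for k
    using that
  proof (induction k)
    case 0
    then show ?case by (intro exI[of _ "{}"]) simp
  next
    case (Suc k)
    then obtain S f where S: "S \<subseteq> X" "card S = k" "inj_on f S" "f ` S \<subseteq> Y" "\<forall>x\<in>S. E x (f x)"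
      by auto
    have finS: "finite S" using S(1) fin(1) finite_subset by blast
    have "S \<noteq> X" using S(2) Suc.prems by auto
    then obtain u where u: "u \<in> X" "u \<notin> S" using S(1) by blast
    have "card (f ` S) = k" using S card_image by blast
    then have "f ` S \<noteq> Y" using Suc.prems eq by auto
    then obtain v where v: "v \<in> Y" "v \<notin> f ` S" using S(4) by blast
    have ext: ?case if "inj_on g (insert u S)" "g ` insert u S \<subseteq> Y" "\<forall>x\<in>insert u S. E x (g x)" for g
      using that u S finS by (intro exI[of _ "insert u S"] exI[of _ g]) auto
    consider (out) y where "y \<in> Y" "E u y" "y \<notin> f ` S"
      | (inn) x where "x \<in> X" "E x v" "x \<notin> S"
      | (both) "{y \<in> Y. E u y} \<subseteq> f ` S" "{x \<in> X. E x v} \<subseteq> S"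
      by blast
    then show ?case
    proof cases
      case out
      show ?thesis
        by (rule ext[of "f(u := y)"]) (use out u S in \<open>auto simp: inj_on_def\<close>)
    next
      case inn
      show ?thesis
        using inn v S finS
        by (intro exI[of _ "insert x S"] exI[of _ "f(x := v)"]) (auto simp: inj_on_def)
    next
      case both
      \<comment> \<open>\<open>T\<close> consists of the partners of the neighbours of
        \<open>u\<close>. It lies in \<open>S\<close>, as do the neighbours of \<open>v\<close>; the
        degree sum exceeds \<open>card S\<close>, so the two sets meet.\<close>
      define T where "T = {x \<in> S. E u (f x)}"
      have "f ` T = {y \<in> Y. E u y}" using both S(4) by (auto simp: T_def)
      then have cT: "card T = card {y \<in> Y. E u y}"
        using S(3) by (metis (no_types, lifting) T_def card_image inj_on_subset mem_Collect_eq subsetI)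
      have "\<not> E u v" using both(2) u by auto
      then have "card X \<le> card T + card {x \<in> X. E x v}" using deg u v cT by simp
      moreover have "card S < card X" using S(2) Suc.prems by simp
      moreover have "card (T \<union> {x \<in> X. E x v}) \<le> card S"
        using both finS by (intro card_mono) (auto simp: T_def)
      ultimately have "T \<inter> {x \<in> X. E x v} \<noteq> {}"
        using card_Un_disjoint[of T "{x \<in> X. E x v}"] finS fin by (auto simp: T_def)
      then obtain x where x: "x \<in> S" "E u (f x)" "E x v" by (auto simp: T_def)
      \<comment> \<open>Switching along the augmenting path \<open>u\<close>, \<open>f x\<close>,
        \<open>x\<close>, \<open>v\<close>.\<close>
      show ?thesis
        by (rule ext[of "f(u := f x, x := v)"]) (use x u v S in \<open>auto simp: inj_on_def\<close>)
    qed
  qed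
  from this[OF order_refl] obtain S f where
    S: "S \<subseteq> X" "card S = card X" "inj_on f S" "f ` S \<subseteq> Y" "\<forall>x\<in>S. E x (f x)" by blast
  have SX: "S = X" using card_subset_eq[OF fin(1) S(1,2)] .
  then have "f ` X = Y" using S eq fin card_image card_subset_eq by metis
  then show ?thesis using S SX by (auto simp: bij_betw_def)
qed

section \<open>Inserting vertices into paths\<close>

definition steps :: "'a list \<Rightarrow> ('a \<times> 'a) set" where
  "steps xs = set (zip xs (tl xs))"

lemma steps_simps [simp]:
  "steps [] = {}" "steps [x] = {}" "steps (x # y # xs) = insert (x, y) (steps (y # xs))"
  by (simp_all add: steps_def)

lemma steps_append: "steps (xs @ y # ys) = steps (xs @ [y]) \<union> steps (y # ys)"
proof (induction xs)
  case (Cons x xs)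
  then show ?case by (cases xs) auto
qed simp

lemma steps_split:
  assumes "(p, p') \<in> steps xs"
  obtains ys zs where "xs = ys @ p # p' # zs"
proof -
  have "(p, p') \<in> steps xs \<Longrightarrow> \<exists>ys zs. xs = ys @ p # p' # zs"
  proof (induction xs)
    case (Cons x xs)
    from Cons.prems consider zs where "x # xs = [] @ p # p' # zs" | "(p, p') \<in> steps xs"
      by (cases xs) auto
    then show ?case
    proof cases
      case 2
      then obtain ys zs where "x # xs = (x # ys) @ p # p' # zs" using Cons.IH by auto
      then show ?thesis by blast
    qed blast
  qed simp
  with assms that show ?thesis by blast
qed

definition insertable :: "('a \<Rightarrow> 'a \<Rightarrow> bool) \<Rightarrow> 'a list \<Rightarrow> 'a \<Rightarrow> bool" where
  "insertable E xs q \<longleftrightarrow> (\<exists>(p, p') \<in> steps xs. E p q \<and> E q p')"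

text \<open>Each step \<open>(p, p')\<close> carries at most one of the arcs from \<open>p\<close>
  to \<open>q\<close> and from \<open>q\<close> to \<open>p'\<close>. Only the arc from the last
  vertex to \<open>q\<close> and the arc from \<open>q\<close> to the first vertex belong to no
  step.\<close>

lemma degree_of_not_insertable:
  assumes "\<not> insertable E xs q"
  shows "length (filter (\<lambda>v. E v q) xs) + length (filter (E q) xs) \<le> length xs + 1"
proof -
  \<comment> \<open>The arc from \<open>q\<close> to the head is kept separate, because prepending a
    vertex pairs it with the new arc into \<open>q\<close>.\<close>
  have "length (filter (\<lambda>v. E v q) xs) + length (filter (E q) xs)
      \<le> length xs + (if xs \<noteq> [] \<and> E q (hd xs) then 1 else 0)"
    using assms
  proof (induction xs)
    case (Cons x xs)
    then show ?case by (cases xs) (auto simp: insertable_def)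
  qed simp
  then show ?thesis by (auto split: if_splits)
qed

text \<open>
  The prefix of \<open>Q\<close> inserted at the step \<open>(p, p')\<close> ends with the last vertex of \<open>Q\<close> that has an
  arc to \<open>p'\<close>; hence no later vertex of \<open>Q\<close> needs the step destroyed by this insertion.
\<close>

lemma multi_insertion:
  assumes "successively E K" "successively E Q" "distinct (K @ Q)" "\<forall>q\<in>set Q. insertable E K q"
  shows "\<exists>L. successively E L \<and> distinct L \<and> hd L = hd K \<and> last L = last K
    \<and> set L = set K \<union> set Q"
  using assms
proof (induction "length Q" arbitrary: K Q rule: less_induct)
  case less
  show ?case
  proof (cases Q)
    case Nil
    then show ?thesis using less.prems by (intro exI[of _ K]) simp
  next
    case (Cons q Q')
    then have "insertable E K q" using less.prems by simp
    then obtain p p' where pp: "(p, p') \<in> steps K" "E p q" "E q p'" by (auto simp: insertable_def)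
    from pp(1) obtain A B where K: "K = A @ p # p' # B" by (rule steps_split)
    have "\<exists>s\<in>set Q. E s p'" using pp Cons by auto
    from split_list_last_prop[OF this]
    obtain Q1 r Q2 where Q: "Q = Q1 @ r # Q2" "E r p'" "\<forall>s\<in>set Q2. \<not> E s p'"
      by blast
    define K' where "K' = A @ p # (Q1 @ [r]) @ p' # B"
    \<comment> \<open>The inserted block starts with \<open>q\<close> even if \<open>Q1\<close> is
      empty, so the arc from \<open>p\<close> leads into it.\<close>
    have hdQ: "hd (Q1 @ r # zs) = q" for zs using Q(1) Cons by (cases Q1) auto
    have "successively E K'"
      using less.prems(1,2) pp Q(2) hdQ unfolding K K'_def Q(1)
      by (auto simp: successively_append_iff successively_Cons)
    moreover have "successively E Q2"
      using less.prems(2) Q(1) by (auto simp: successively_append_iff successively_Cons)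
    moreover have "distinct (K' @ Q2)"
      using less.prems(3) by (auto simp: K K'_def Q(1))
    moreover have "insertable E K' s" if s: "s \<in> set Q2" for s
    proof -
      have "insertable E K s" using less.prems(4) Q(1) s by auto
      then obtain t t' where t: "(t, t') \<in> steps K" "E t s" "E s t'"
        by (auto simp: insertable_def)
      have "t' \<noteq> p'" using t Q(3) s by blast
      then have "(t, t') \<in> steps (A @ [p]) \<union> steps (p' # B)"
        using t(1) unfolding K by (subst (asm) steps_append) auto
      moreover have "steps K' = steps (A @ [p]) \<union> steps ((p # Q1 @ [r]) @ [p']) \<union> steps (p' # B)"
        using steps_append[of A p "(Q1 @ [r]) @ p' # B"] steps_append[of "p # Q1 @ [r]" p' B]
        by (simp add: K'_def Un_assoc)
      ultimately show ?thesis using t by (auto simp: insertable_def)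
    qed
    moreover have "length Q2 < length Q" using Q(1) by simp
    ultimately obtain L where L: "successively E L" "distinct L" "hd L = hd K'" "last L = last K'"
      "set L = set K' \<union> set Q2"
      using less.hyps[of Q2 K'] by blast
    have "hd K' = hd K" "last K' = last K" by (auto simp: K K'_def hd_append)
    then show ?thesis using L by (intro exI[of _ L]) (auto simp: K K'_def Q(1))
  qed
qed

text \<open>Closed detours are cut out. This turns the interior of a bypass, which is only a walk,
  into a path that can be part of a cycle.\<close>

lemma successively_shorten:
  assumes "successively E P" "P \<noteq> []"
  shows "\<exists>P'. P' \<noteq> [] \<and> successively E P' \<and> distinct P' \<and> hd P' = hd P \<and> last P' = last P
    \<and> set P' \<subseteq> set P"
  using assms
proof (induction P)
  case (Cons p P)
  show ?case
  proof (cases "P = []")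
    case True
    then show ?thesis by (intro exI[of _ "[p]"]) simp
  next
    case False
    then obtain P' where P': "P' \<noteq> []" "successively E P'" "distinct P'" "hd P' = hd P"
      "last P' = last P" "set P' \<subseteq> set P"
      using Cons by (auto simp: successively_Cons)
    show ?thesis
    proof (cases "p \<in> set P'")
      case True
      then obtain A B where "P' = A @ p # B" by (auto dest: split_list)
      then show ?thesis using P' False
        by (intro exI[of _ "p # B"]) (auto simp: successively_append_iff)
    next
      case False
      then show ?thesis using P' Cons.prems \<open>P \<noteq> []\<close>
        by (intro exI[of _ "p # P'"]) (auto simp: successively_Cons)
    qed
  qed
qed simp

section \<open>Woodall's theorem\<close>

text \<open>A single vertex with a loop qualifies, so a length of at least 2 has to be asked for
  separately.\<close>

definition cyclic_list :: "('a \<Rightarrow> 'a \<Rightarrow> bool) \<Rightarrow> 'a list \<Rightarrow> bool" where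
  "cyclic_list E xs \<longleftrightarrow>
     xs \<noteq> [] \<and> distinct xs \<and> successively E xs \<and> E (last xs) (hd xs)"

lemma cyclic_list_rotate: "cyclic_list E (xs @ ys) \<Longrightarrow> cyclic_list E (ys @ xs)"
proof (cases "xs = [] \<or> ys = []")
  case False
  then show "cyclic_list E (xs @ ys) \<Longrightarrow> cyclic_list E (ys @ xs)"
    by (simp add: cyclic_list_def successively_append_iff Int_commute)
qed auto

lemma cyclic_list_insert:
  assumes "cyclic_list E (K @ Q)" "insertable E K z" "z \<notin> set (K @ Q)"
  shows "\<exists>C. cyclic_list E C \<and> set C = insert z (set (K @ Q))"
proof -
  obtain p p' where p: "(p, p') \<in> steps K" "E p z" "E z p'"
    using assms(2) by (auto simp: insertable_def)
  from p(1) obtain A B where K: "K = A @ p # p' # B" by (rule steps_split)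
  \<comment> \<open>After rotation the step \<open>(p, p')\<close> is the closing arc, and
    \<open>z\<close> can be put in front.\<close>
  have "cyclic_list E ((p' # B @ Q) @ A @ [p])"
    using assms(1) cyclic_list_rotate[of E "A @ [p]" "p' # B @ Q"] by (simp add: K)
  then have "cyclic_list E (z # (p' # B @ Q) @ A @ [p])"
    using p assms(3) by (auto simp: cyclic_list_def K successively_Cons)
  then show ?thesis
    by (intro exI[of _ "z # (p' # B @ Q) @ A @ [p]"]) (auto simp: K)
qed

text \<open>The cycle \<open>K @ Q\<close> is cut so that \<open>P\<close> runs parallel to the gap
  \<open>Q\<close>, from the end of \<open>K\<close> back to its start. \<open>P\<close> may repeat
  vertices, so it can be extended without checking distinctness.\<close>

definition bypass :: "('a \<Rightarrow> 'a \<Rightarrow> bool) \<Rightarrow> 'a set \<Rightarrow> 'a list \<Rightarrow> 'a list \<Rightarrow> 'a list \<Rightarrow> bool" where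
  "bypass E V K Q P \<longleftrightarrow>
     P \<noteq> [] \<and> set P \<subseteq> V - set (K @ Q) \<and> successively E P \<and> E (last K) (hd P) \<and> E (last P) (hd K)"

text \<open>
  \<open>E\<close> may have loops, and they count in the degrees: this explains the bound \<open>card V + 2\<close>, where
  Woodall's theorem for loopless digraphs has \<open>card V\<close>.
\<close>

locale woodall =
  fixes V :: "'a set" and E :: "'a \<Rightarrow> 'a \<Rightarrow> bool"
  assumes finite_V: "finite V"
    and degree_sum: "\<And>u v. u \<in> V \<Longrightarrow> v \<in> V \<Longrightarrow> u \<noteq> v \<Longrightarrow> \<not> E u v \<Longrightarrow>
      card V + 2 \<le> card {w \<in> V. E u w} + card {w \<in> V. E w v}"
begin

text \<open>The out-neighbours of \<open>u\<close> and the in-neighbours of \<open>v\<close> share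
  at least two vertices, hence one other than \<open>c\<close>. As \<open>u\<close> has no arc to
  \<open>v\<close>, the vertex \<open>w\<close> differs from both.\<close>

lemma two_step:
  assumes "u \<in> V" "v \<in> V" "u \<noteq> v" "\<not> E u v"
  obtains w where "w \<in> V" "E u w" "E w v" "w \<noteq> c"
proof -
  let ?A = "{w \<in> V. E u w}" and ?B = "{w \<in> V. E w v}"
  have "card (?A \<union> ?B) \<le> card V" using finite_V by (intro card_mono) auto
  moreover have "card ?A + card ?B = card (?A \<union> ?B) + card (?A \<inter> ?B)"
    using finite_V by (intro card_Un_Int) auto
  ultimately have "2 \<le> card (?A \<inter> ?B)" using degree_sum[OF assms] by linarith
  moreover have "card (?A \<inter> ?B) \<le> 1" if "?A \<inter> ?B \<subseteq> {c}"
    using card_mono[OF _ that] by simp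
  ultimately have "\<not> ?A \<inter> ?B \<subseteq> {c}" by linarith
  then show ?thesis using that by blast
qed

lemma ex_cyclic_list:
  assumes "2 \<le> card V"
  obtains C where "cyclic_list E C" "set C \<subseteq> V" "2 \<le> length C"
proof -
  from assms obtain u v where uv: "u \<in> V" "v \<in> V" "u \<noteq> v"
    by (metis card_le_Suc0_iff_eq finite_V not_less_eq_eq numeral_2_eq_2)
  show ?thesis
  proof (cases "E u v")
    case True
    show ?thesis
    proof (cases "E v u")
      case True
      then show ?thesis using that[of "[u, v]"] uv \<open>E u v\<close> by (simp add: cyclic_list_def)
    next
      case False
      then obtain w where "w \<in> V" "E v w" "E w u" using two_step uv by metis
      then show ?thesis using that[of "[u, v, w]"] uv \<open>E u v\<close> False
        by (auto simp: cyclic_list_def)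
    qed
  next
    case False
    then obtain w where w: "w \<in> V" "E u w" "E w v" using two_step uv by metis
    show ?thesis
    proof (cases "E v u")
      case True
      then show ?thesis using that[of "[u, w, v]"] uv w False by (auto simp: cyclic_list_def)
    next
      case nvu: False
      \<comment> \<open>Avoiding \<open>w\<close> keeps the two connections between \<open>u\<close>
        and \<open>v\<close> disjoint.\<close>
      then obtain w' where "w' \<in> V" "E v w'" "E w' u" "w' \<noteq> w" using two_step uv by metis
      then show ?thesis using that[of "[u, w, v, w']"] uv w False nvu
        by (auto simp: cyclic_list_def)
    qed
  qed
qed

lemma ex_bypass:
  assumes C: "cyclic_list E C" "set C \<subseteq> V" "2 \<le> length C" and "set C \<noteq> V"
  obtains K Q P where "cyclic_list E (K @ Q)" "set (K @ Q) = set C" "K \<noteq> []" "bypass E V K Q P"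
proof -
  obtain r where r: "r \<in> V" "r \<notin> set C" using assms by blast
  obtain c where c: "c \<in> set C" using C(3) by (cases C) auto
  obtain x z where xz: "x \<in> set C" "z \<in> V" "z \<notin> set C" "E x z"
  proof (cases "E c r")
    case True
    then show ?thesis using that c r by blast
  next
    case False
    \<comment> \<open>The walk \<open>c\<close>, \<open>w\<close>, \<open>r\<close> leaves the cycle
      at \<open>w\<close> if \<open>w\<close> lies on it, and at \<open>c\<close> otherwise.\<close>
    then obtain w where "w \<in> V" "E c w" "E w r" using two_step[of c r] c r C(2) by blast
    then show ?thesis using that c r by blast
  qed
  have "\<exists>y\<in>set C. y \<noteq> x"
  proof (rule ccontr)
    assume "\<not> ?thesis"
    then have "set C \<subseteq> {x}" by blast
    then have "card (set C) \<le> 1" using card_mono[of "{x}" "set C"] by simp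
    then show False using C by (simp add: cyclic_list_def distinct_card)
  qed
  then obtain y0 where y0: "y0 \<in> set C" "y0 \<noteq> x" by blast
  obtain y P where yP: "y \<in> set C" "y \<noteq> x" "P \<noteq> []" "set P \<subseteq> V - set C" "successively E P"
    "E x (hd P)" "E (last P) y"
  proof (cases "E z y0")
    case True
    then show ?thesis using that[of y0 "[z]"] xz y0 by simp
  next
    case False
    \<comment> \<open>Since \<open>w\<close> differs from \<open>x\<close>, it can serve as the
      return vertex if it lies on the cycle.\<close>
    then obtain w where w: "w \<in> V" "E z w" "E w y0" "w \<noteq> x"
      using two_step[of z y0] xz y0 C(2) by blast
    show ?thesis
    proof (cases "w \<in> set C")
      case True
      then show ?thesis using that[of w "[z]"] xz w by simp
    next
      case False
      then show ?thesis using that[of y0 "[z, w]"] xz w y0 by simp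
    qed
  qed
  \<comment> \<open>Two rotations bring \<open>x\<close> to the end of \<open>K\<close> and
    \<open>y\<close> to its start; the vertices strictly between \<open>x\<close> and
    \<open>y\<close> form the gap.\<close>
  obtain A B where AB: "C = A @ x # B" using xz(1) by (auto dest: split_list)
  have cyc: "cyclic_list E (B @ A @ [x])"
    using C(1) cyclic_list_rotate[of E "A @ [x]" B] by (simp add: AB)
  have "y \<in> set (B @ A)" using yP AB by auto
  then obtain S T where ST: "B @ A = S @ y # T" by (meson split_list)
  have "cyclic_list E ((y # T @ [x]) @ S)"
    using cyc cyclic_list_rotate[of E S "y # T @ [x]"] ST by (metis append.assoc append_Cons)
  moreover have "set ((y # T @ [x]) @ S) = set C"
    using arg_cong[OF ST, of set] by (auto simp: AB)
  ultimately show ?thesis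
    using that[of "y # T @ [x]" S P] yP by (simp add: bypass_def)
qed

text \<open>
  Minimality of the gap \<open>Q\<close> makes \<open>z\<close> and \<open>q\<close> non-adjacent and excludes outer common
  neighbours of either orientation, so the two degree sums of \<open>z\<close> and \<open>q\<close> can only be
  reached if \<open>q\<close> has more than \<open>length K + 1\<close> arcs to and from \<open>K\<close>.
\<close>

lemma insertable_of_minimal_bypass:
  assumes cyc: "cyclic_list E (K @ Q)" "set (K @ Q) \<subseteq> V" and K: "K \<noteq> []"
    and P: "bypass E V K Q P"
    and longest: "\<And>C. cyclic_list E C \<Longrightarrow> set C \<subseteq> V \<Longrightarrow> length C \<le> length (K @ Q)"
    and minimal: "\<And>K' Q' P'. cyclic_list E (K' @ Q') \<Longrightarrow> set (K' @ Q') = set (K @ Q) \<Longrightarrow> K' \<noteq> [] \<Longrightarrow>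
      bypass E V K' Q' P' \<Longrightarrow> length Q \<le> length Q'"
    and q: "q \<in> set Q"
  shows "insertable E K q"
proof (rule ccontr)
  assume nq: "\<not> insertable E K q"
  define z where "z = hd P"
  define R where "R = V - set (K @ Q)"
  have PR: "P \<noteq> []" "set P \<subseteq> R" "successively E P" "E (last K) z" "E (last P) (hd K)"
    using P by (auto simp: bypass_def R_def z_def)
  have zR: "z \<in> R" using PR by (auto simp: z_def)
  \<comment> \<open>Such an arc would give a bypass returning already at \<open>q'\<close>, with the
    shorter gap \<open>Q1\<close>.\<close>
  have no_into: "\<not> E (last P') q'"
    if "P' \<noteq> []" "set P' \<subseteq> R" "successively E P'" "hd P' = z" "q' \<in> set Q" for P' q'
  proof
    assume *: "E (last P') q'"
    obtain Q1 Q2 where Q: "Q = Q1 @ q' # Q2" using \<open>q' \<in> set Q\<close> by (auto dest: split_list)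
    have "bypass E V (q' # Q2 @ K) Q1 P'"
      using * that PR K by (auto simp: bypass_def R_def Q)
    moreover have "cyclic_list E ((q' # Q2 @ K) @ Q1)"
      using cyc(1) cyclic_list_rotate[of E "K @ Q1" "q' # Q2"] by (simp add: Q)
    ultimately show False using minimal[of "q' # Q2 @ K" Q1 P'] by (auto simp: Q)
  qed
  \<comment> \<open>Symmetrically, a bypass leaving only at \<open>q'\<close> would have the shorter
    gap \<open>Q2\<close>.\<close>
  have no_from: "\<not> E q' (hd P')"
    if "P' \<noteq> []" "set P' \<subseteq> R" "successively E P'" "last P' = last P" "q' \<in> set Q" for P' q'
  proof
    assume *: "E q' (hd P')"
    obtain Q1 Q2 where Q: "Q = Q1 @ q' # Q2" using \<open>q' \<in> set Q\<close> by (auto dest: split_list)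
    have "bypass E V (K @ Q1 @ [q']) Q2 P'"
      using * that PR K by (auto simp: bypass_def R_def Q)
    then show False using minimal[of "K @ Q1 @ [q']" Q2 P'] cyc(1) K by (auto simp: Q)
  qed
  have zQ: "\<not> E z q'" "\<not> E q' z" if "q' \<in> set Q" for q'
    using no_into[of "[z]"] no_from[of P] zR PR that by (simp_all add: z_def)
  have zRq: "\<not> E w q" if "w \<in> R" "E z w" for w
    using no_into[of "[z, w]"] zR that q by simp
  \<comment> \<open>Here \<open>w\<close> may already occur in \<open>P\<close>, which is harmless
    since bypasses are walks.\<close>
  have qRz: "\<not> E w z" if "w \<in> R" "E q w" for w
    using no_from[of "w # P"] PR that q by (auto simp: successively_Cons z_def)
  have nz: "\<not> insertable E K z"
  proof
    assume "insertable E K z"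
    then obtain C where C: "cyclic_list E C" "set C = insert z (set (K @ Q))"
      using cyclic_list_insert cyc(1) zR by (metis DiffD2 R_def)
    have "length C = card (set C)" "length (K @ Q) = card (set (K @ Q))"
      using C cyc by (metis cyclic_list_def distinct_card)+
    then have "length C = Suc (length (K @ Q))" using C zR by (simp add: R_def)
    then show False using longest[of C] C cyc(2) zR by (simp add: R_def)
  qed
  have dist: "distinct (K @ Q)" using cyc(1) by (simp add: cyclic_list_def)
  have finR: "finite R" using finite_V by (simp add: R_def)
  have split: "card {w \<in> V. F w} = length (filter F K) + card {w \<in> set Q. F w} + card {w \<in> R. F w}"
    for F
  proof -
    have "{w \<in> V. F w} = {w \<in> set K. F w} \<union> ({w \<in> set Q. F w} \<union> {w \<in> R. F w})"
      using cyc(2) by (auto simp: R_def)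
    moreover have "card \<dots> = card {w \<in> set K. F w} + card ({w \<in> set Q. F w} \<union> {w \<in> R. F w})"
      using dist finR by (intro card_Un_disjoint) (auto simp: R_def)
    moreover have "card ({w \<in> set Q. F w} \<union> {w \<in> R. F w})
        = card {w \<in> set Q. F w} + card {w \<in> R. F w}"
      using finR by (intro card_Un_disjoint) (auto simp: R_def)
    moreover have "card {w \<in> set K. F w} = length (filter F K)"
      using dist by (metis distinct_append distinct_card distinct_filter set_filter)
    ultimately show ?thesis by simp
  qed
  have V: "card V = length K + card (set Q) + card R"
    using split[of "\<lambda>_. True"] by simp
  have disjoint_bound: "card {w \<in> R. F w} + card {w \<in> R. G w} \<le> card R"
    if "\<And>w. w \<in> R \<Longrightarrow> F w \<Longrightarrow> \<not> G w" for F G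
  proof -
    have "card {w \<in> R. F w} + card {w \<in> R. G w} = card ({w \<in> R. F w} \<union> {w \<in> R. G w})"
      using that finR by (intro card_Un_disjoint[symmetric]) auto
    also have "\<dots> \<le> card R" using finR by (intro card_mono) auto
    finally show ?thesis .
  qed
  have Qz: "{w \<in> set Q. E z w} = {}" "{w \<in> set Q. E w z} = {}" using zQ by auto
  have Qq: "card {w \<in> set Q. F w} \<le> card (set Q)" for F by (intro card_mono) auto
  have "card V + 2 \<le> card {w \<in> V. E z w} + card {w \<in> V. E w q}"
    "card V + 2 \<le> card {w \<in> V. E q w} + card {w \<in> V. E w z}"
    using degree_sum[of z q] degree_sum[of q z] zR q cyc(2) zQ[OF q] by (auto simp: R_def)
  moreover have "card {w \<in> R. E z w} + card {w \<in> R. E w q} \<le> card R"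
    "card {w \<in> R. E q w} + card {w \<in> R. E w z} \<le> card R"
    using zRq qRz by (intro disjoint_bound; blast)+
  \<comment> \<open>The two sums together are at most \<open>2 * (length K + 1)\<close> from
    \<open>K\<close>, \<open>2 * card (set Q)\<close> from \<open>Q\<close>, where only
    \<open>q\<close> contributes, and \<open>2 * card R\<close> from \<open>R\<close>. This is
    \<open>2 * card V + 2\<close>, less than the required \<open>2 * card V + 4\<close>.\<close>
  ultimately show False
    using degree_of_not_insertable[OF nz] degree_of_not_insertable[OF nq]
      Qq[of "E q"] Qq[of "\<lambda>w. E w q"]
    unfolding V split Qz by simp
qed

theorem hamiltonian:
  assumes "2 \<le> card V"
  obtains C where "cyclic_list E C" "set C = V"
proof -
  define cyc where "cyc C \<longleftrightarrow> cyclic_list E C \<and> set C \<subseteq> V" for C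
  have len: "length C = card (set C)" if "cyc C" for C
    using that by (simp add: cyc_def cyclic_list_def distinct_card)
  have bound: "length C \<le> card V" if "cyc C" for C
    unfolding len[OF that] using that finite_V by (intro card_mono) (auto simp: cyc_def)
  obtain C0 where C0: "cyc C0" "2 \<le> length C0"
    unfolding cyc_def by (rule ex_cyclic_list[OF assms]) blast
  obtain C where C: "cyc C" "\<And>C'. cyc C' \<Longrightarrow> length C' \<le> length C"
    using ex_has_greatest_nat[of cyc C0 length "Suc (card V)"] C0(1) bound
    by (metis less_Suc_eq_le)
  show ?thesis
  proof (cases "set C = V")
    case True
    then show ?thesis using that C by (auto simp: cyc_def)
  next
    case False
    \<comment> \<open>The gap is minimised over all cycles on the vertex set of \<open>C\<close>,
      not only over cuts of \<open>C\<close> itself.\<close>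
    define good where "good = (\<lambda>(K, Q, P). cyclic_list E (K @ Q) \<and> set (K @ Q) = set C
      \<and> K \<noteq> [] \<and> bypass E V K Q P)"
    have "cyclic_list E C" "set C \<subseteq> V" "2 \<le> length C"
      using C(1) C(2)[OF C0(1)] C0(2) by (simp_all add: cyc_def)
    from ex_bypass[OF this False] obtain K0 Q0 P0 where
      "cyclic_list E (K0 @ Q0)" "set (K0 @ Q0) = set C" "K0 \<noteq> []" "bypass E V K0 Q0 P0" .
    then have "good (K0, Q0, P0)" by (simp add: good_def)
    from ex_has_least_nat[of good, OF this, of "\<lambda>t. length (fst (snd t))"]
    obtain t where t: "good t"
      "\<And>t'. good t' \<Longrightarrow> length (fst (snd t)) \<le> length (fst (snd t'))"
      by blast
    obtain K Q P where tKQP: "t = (K, Q, P)" by (cases t)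
    have g: "cyclic_list E (K @ Q)" "set (K @ Q) = set C" "K \<noteq> []" "bypass E V K Q P"
      using t(1) by (auto simp: tKQP good_def)
    have KQ: "cyc (K @ Q)" using g C by (auto simp: cyc_def)
    have lenKQ: "length (K @ Q) = length C" using len[OF KQ] len[OF C(1)] g(2) by metis
    have "insertable E K q" if "q \<in> set Q" for q
    proof (rule insertable_of_minimal_bypass[OF g(1) _ g(3) g(4)])
      show "set (K @ Q) \<subseteq> V" using KQ by (simp add: cyc_def)
      show "length C' \<le> length (K @ Q)" if "cyclic_list E C'" "set C' \<subseteq> V" for C'
        unfolding lenKQ using C(2)[of C'] that by (simp add: cyc_def)
      show "length Q \<le> length Q'"
        if "cyclic_list E (K' @ Q')" "set (K' @ Q') = set (K @ Q)" "K' \<noteq> []" "bypass E V K' Q' P'"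
        for K' Q' P'
        using t(2)[of "(K', Q', P')"] that g(2) by (simp add: good_def tKQP)
    qed (rule that)
    moreover have "successively E K" "successively E Q" "distinct (K @ Q)"
      using g(1) by (auto simp: cyclic_list_def successively_append_iff)
    ultimately obtain L where L: "successively E L" "distinct L" "hd L = hd K" "last L = last K"
      "set L = set K \<union> set Q"
      using multi_insertion[of E K Q] by auto
    have "P \<noteq> []" "set P \<subseteq> V - set (K @ Q)" "successively E P" "E (last K) (hd P)"
      "E (last P) (hd K)"
      using g(4) by (auto simp: bypass_def)
    moreover from this obtain P' where "P' \<noteq> []" "successively E P'" "distinct P'"
      "hd P' = hd P" "last P' = last P" "set P' \<subseteq> set P"
      using successively_shorten by metis
    ultimately have P': "P' \<noteq> []" "successively E P'" "distinct P'" "set P' \<subseteq> V - set (K @ Q)"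
      "E (last K) (hd P')" "E (last P') (hd K)" by auto
    have "L \<noteq> []" using L(5) g(3) by auto
    \<comment> \<open>\<open>L\<close> has the ends of \<open>K\<close> and contains all vertices of
      \<open>C\<close>, so closing it through \<open>P'\<close> gives a longer cycle.\<close>
    then have "cyclic_list E (L @ P')"
      using L P' by (auto simp: cyclic_list_def successively_append_iff)
    moreover have "set (L @ P') \<subseteq> V" using L P' KQ by (auto simp: cyc_def)
    ultimately have "length (L @ P') \<le> length C" using C(2)[of "L @ P'"] by (simp add: cyc_def)
    moreover have "length L = length (K @ Q)"
      using L(2,5) len[OF KQ] distinct_card[of L] by simp
    ultimately show ?thesis using lenKQ P'(1) by simp
  qed
qed

end

section \<open>Bipartite digraphs\<close>

text \<open>Each contracted vertex \<open>x\<close> is expanded to its matching arc from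
  \<open>x\<close> to \<open>f x\<close>; an arc from \<open>f x\<close> to \<open>x'\<close> joins
  consecutive blocks.\<close>

lemma cyclic_list_concat:
  assumes "vs \<noteq> []" "distinct vs" "successively (\<lambda>x x'. (f x, x') \<in> A) vs" "(f (last vs), hd vs) \<in> A"
    and "\<forall>x\<in>set vs. (x, f x) \<in> A" "inj_on f (set vs)" "f ` set vs \<inter> set vs = {}"
  shows "cyclic_list (\<lambda>u v. (u, v) \<in> A) (concat (map (\<lambda>x. [x, f x]) vs))" (is "cyclic_list ?A ?c")
proof -
  have "successively ?A ?c"
    using assms(3,5)
  proof (induction vs)
    case (Cons x xs)
    then show ?case by (cases xs) simp_all
  qed simp
  moreover have "distinct ?c"
    using assms(2,6,7)
  proof (induction vs)
    case (Cons x xs)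
    have "x \<noteq> f x" "x \<notin> f ` set xs" "f x \<notin> set xs" "f x \<notin> f ` set xs"
      using Cons.prems by (auto simp: inj_on_def)
    moreover have "distinct (concat (map (\<lambda>x. [x, f x]) xs))"
      using Cons.prems by (intro Cons.IH) (auto simp: inj_on_def)
    ultimately show ?case using Cons.prems(1) by auto
  qed simp
  moreover have "hd ?c = hd vs" "?c \<noteq> []"
    using assms(1) by (cases vs; simp)+
  moreover have "last ?c = f (last vs)"
    using assms(1) by (cases vs rule: rev_cases) simp_all
  ultimately show ?thesis using assms by (simp add: cyclic_list_def)
qed

theorem theorem1p2:
  fixes D :: "'a pair_pre_digraph" and X Y :: "'a set" and a :: nat
  assumes "a \<ge> 2"
    and "pair_digraph D"
    and "bipartite_classes D X Y"
    and "card X = a" and "card Y = a"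
    and "condition_A2_star a D X Y"
  shows "\<exists>p. pre_digraph.cycle (with_proj D) p \<and> length p = 2 * a"
proof -
  interpret pair_digraph D by fact
  let ?A = "parcs D"
  have XY: "pverts D = X \<union> Y" "X \<inter> Y = {}" "?A \<inter> X \<times> X = {}" "?A \<inter> Y \<times> Y = {}"
    using assms(3) by (auto simp: bipartite_classes_def)
  have fin: "finite X" "finite Y" using finite_verts XY(1) by simp_all
  have nbrs: "{v. (u, v) \<in> ?A} = {v \<in> Y. (u, v) \<in> ?A}" "{v. (v, u) \<in> ?A} = {v \<in> Y. (v, u) \<in> ?A}"
    if "u \<in> X" for u
    using that XY in_arcsD1 in_arcsD2 by blast+
  have nbrs': "{v. (u, v) \<in> ?A} = {v \<in> X. (u, v) \<in> ?A}" "{v. (v, u) \<in> ?A} = {v \<in> X. (v, u) \<in> ?A}"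
    if "u \<in> Y" for u
    using that XY in_arcsD1 in_arcsD2 by blast+
  have deg: "a + 2 \<le> card {w. (u, w) \<in> ?A} + card {w. (w, v) \<in> ?A}"
    if "u \<in> X \<and> v \<in> Y \<or> u \<in> Y \<and> v \<in> X" "(u, v) \<notin> ?A" for u v
    using assms(6) that
    unfolding condition_A2_star_def out_degree_with_proj in_degree_with_proj by blast
  have "\<exists>f. bij_betw f X Y \<and> (\<forall>x\<in>X. (x, f x) \<in> ?A)"
  proof (rule matching_of_degree_sum[OF fin])
    fix u v assume uv: "u \<in> X" "v \<in> Y" "(u, v) \<notin> ?A"
    then have "a + 2 \<le> card {w. (u, w) \<in> ?A} + card {w. (w, v) \<in> ?A}" by (intro deg) auto
    then show "card X \<le> card {y \<in> Y. (u, y) \<in> ?A} + card {x \<in> X. (x, v) \<in> ?A}"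
      using assms(4) nbrs(1)[OF uv(1)] nbrs'(2)[OF uv(2)] by simp
  qed (simp add: assms)
  then obtain f where f: "bij_betw f X Y" "\<forall>x\<in>X. (x, f x) \<in> ?A" by blast
  have "woodall X (\<lambda>x x'. (f x, x') \<in> ?A)"
  proof
    fix u v assume uv: "u \<in> X" "v \<in> X" "(f u, v) \<notin> ?A"
    have fu: "f u \<in> Y" using f(1) uv(1) by (auto simp: bij_betw_def)
    \<comment> \<open>The contracted in-degree of \<open>v\<close> is its in-degree in
      \<open>D\<close>, via \<open>f\<close>; the contracted out-degree of \<open>u\<close> is the
      out-degree of \<open>f u\<close>. An arc from \<open>f u\<close> back to \<open>u\<close>
      becomes a loop, so nothing is lost from the bound \<open>a + 2\<close>.\<close>
    have "{w \<in> Y. (w, v) \<in> ?A} = f ` {x \<in> X. (f x, v) \<in> ?A}"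
      using f(1) by (auto simp: bij_betw_def)
    moreover have "inj_on f {x \<in> X. (f x, v) \<in> ?A}"
      using f(1) by (auto simp: bij_betw_def inj_on_def)
    ultimately have "card {w. (w, v) \<in> ?A} = card {x \<in> X. (f x, v) \<in> ?A}"
      using nbrs(2)[OF uv(2)] by (simp add: card_image)
    moreover have "a + 2 \<le> card {w. (f u, w) \<in> ?A} + card {w. (w, v) \<in> ?A}"
      using uv fu by (intro deg) auto
    ultimately show "card X + 2 \<le> card {w \<in> X. (f u, w) \<in> ?A} + card {w \<in> X. (f w, v) \<in> ?A}"
      using nbrs'(1)[OF fu] assms(4) by simp
  qed (rule fin)
  then obtain vs where vs: "cyclic_list (\<lambda>x x'. (f x, x') \<in> ?A) vs" "set vs = X"
    using woodall.hamiltonian assms(1,4) by blast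
  define c where "c = concat (map (\<lambda>x. [x, f x]) vs)"
  have c: "cyclic_list (\<lambda>u v. (u, v) \<in> ?A) c"
    unfolding c_def using vs f XY(2)
    by (intro cyclic_list_concat) (auto simp: cyclic_list_def bij_betw_def)
  have "length vs = a" using vs assms(4) by (metis cyclic_list_def distinct_card)
  then have "length c = 2 * a"
    unfolding c_def by (simp add: length_concat comp_def sum_list_triv)
  then have "\<exists>vs. distinct vs \<and> length vs = 2 * a
      \<and> (\<forall>i. Suc i < 2 * a \<longrightarrow> (vs ! i, vs ! Suc i) \<in> ?A) \<and> (vs ! (2 * a - 1), vs ! 0) \<in> ?A"
    using c by (intro exI[of _ c])
      (auto simp: cyclic_list_def successively_conv_nth hd_conv_nth last_conv_nth)
  then show ?thesis using ex_cycle_iff_vertices[of "2 * a"] assms(1) by simp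
qed

end
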